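(* Let $R$ be either the free associative algebra $\mathcal{A}_r$ or the free group algebra $\mathcal{F}_r$ of (finite) rank $r>1$ over a field $\Phi$, $M$ a right $R$-module of maximal growth, and $N$ a submodule of $M$. Then at least one of $N$, $M/N$ is an $R$-module of maximal growth. In other words, the class $\mathfrak{N}$ of $R$-modules in which no submodule has maximal growth is closed under extensions.
   Context: $X$ is a finite set with $r>1$ elements; $\mathcal{A}_r=\Phi\langle X\rangle$ is the free associative algebra with $1$ on $X$, and $\mathcal{F}_r=\Phi F_r$ is the group algebra of the free group $F_r$ with free basis $X$. Put $R(n)$ equal to the linear span of all words in $X$ of length at most $n$ (for $R=\mathcal{A}_r$), respectively of all elements of $F_r$ of reduced length at most $n$ in $X\cup X^{-1}$ (for $R=\mathcal{F}_r$). For a right $R$-module $V$ generated by a finite set $A$ the growth function is $g_{A,V}(n)=\dim_\Phi(A R(n))$. Functions $f,g$ are equivalent if for some nonnegative integers $C,C'$ one has $f(n)\le g(n+C)$ and $g(n)\le f(n+C')$ for all $n\ge0$. A finitely generated module has maximal growth if its growth function is equivalent to that of the free module of rank 1, i.e. to $r^n$ (for $\mathcal{A}_r$) or $(2r-1)^n$ (for $\mathcal{F}_r$); this does not depend on the finite generating set. An arbitrary (not necessarily finitely generated) module is of maximal growth if it contains a finitely generated submodule of maximal growth. *)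

theory Defs
  imports
    "HOL-Library.Poly_Mapping"
    "HOL-Library.Cardinality"
    "HOL-Algebra.QuotRing"
    "Jordan_Normal_Form.VS_Connect"
begin

section \<open>Free monoids and free groups\<close>

text \<open>
  The type \<open>'g \<Rightarrow>\<^sub>0 'k\<close> with its convolution product is the monoid algebra of \<open>'g\<close>
  over \<open>'k\<close>, where the operation of the monoid \<open>'g\<close> is written additively.
  (The class \<^class>\<open>monoid_add\<close> does not require commutativity.)
  Accordingly, the free monoid and the free group are written additively below.
\<close>

class monoid_with_length = monoid_add +
  fixes wlen :: "'a \<Rightarrow> nat"

datatype 'x free_monoid = Word (letters: "'x list")

instantiation free_monoid :: (type) monoid_with_length
begin

definition zero_free_monoid :: "'a free_monoid"
  where "0 = Word []"

definition plus_free_monoid :: "'a free_monoid \<Rightarrow> 'a free_monoid \<Rightarrow> 'a free_monoid"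
  where "u + v = Word (letters u @ letters v)"

definition wlen_free_monoid :: "'a free_monoid \<Rightarrow> nat"
  where "wlen u = length (letters u)"

instance
  by standard (simp_all add: zero_free_monoid_def plus_free_monoid_def)

end

text \<open>
  The letter \<open>(x, True)\<close> stands for the generator \<open>x\<close> and \<open>(x, False)\<close> for its inverse.
  The elements of the free group are the reduced words; the product of two
  reduced words is computed by multiplying the letters of the first one, from
  right to left, onto the second one.
\<close>

definition inv_letter :: "'x \<times> bool \<Rightarrow> 'x \<times> bool"
  where "inv_letter a = (fst a, \<not> snd a)"

definition reduced :: "('x \<times> bool) list \<Rightarrow> bool"
  where "reduced = successively (\<lambda>a b. b \<noteq> inv_letter a)"

definition lmult :: "'x \<times> bool \<Rightarrow> ('x \<times> bool) list \<Rightarrow> ('x \<times> bool) list"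
  where "lmult a w = (case w of [] \<Rightarrow> [a] | b # w' \<Rightarrow> if b = inv_letter a then w' else a # w)"

lemma inv_letter_inv_letter [simp]: "inv_letter (inv_letter a) = a"
  by (simp add: inv_letter_def)

lemma inv_letter_neq [simp]: "inv_letter a \<noteq> a" "a \<noteq> inv_letter a"
  by (simp_all add: inv_letter_def prod_eq_iff)

lemma reduced_Nil [simp]: "reduced []"
  by (simp add: reduced_def)

lemma reduced_ConsD: "reduced (a # w) \<Longrightarrow> reduced w"
  by (cases w) (simp_all add: reduced_def)

lemma reduced_lmult: "reduced w \<Longrightarrow> reduced (lmult a w)"
  by (cases w) (auto simp: lmult_def reduced_def dest: reduced_ConsD[unfolded reduced_def])

lemma lmult_inv_letter_lmult: "reduced w \<Longrightarrow> lmult (inv_letter a) (lmult a w) = w"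
  by (cases w; cases "tl w") (auto simp: lmult_def reduced_def)

lemma lmult_lmult_inv_letter: "reduced w \<Longrightarrow> lmult a (lmult (inv_letter a) w) = w"
  using lmult_inv_letter_lmult[of w "inv_letter a"] by simp

lemma reduced_foldr_lmult: "reduced v \<Longrightarrow> reduced (foldr lmult u v)"
  by (induction u) (simp_all add: reduced_lmult)

lemma foldr_lmult_Nil: "reduced u \<Longrightarrow> foldr lmult u [] = u"
proof (induction u)
  case (Cons a u)
  then have "foldr lmult u [] = u"
    by (blast dest: reduced_ConsD)
  moreover have "lmult a u = a # u"
    using Cons.prems by (cases u) (simp_all add: lmult_def reduced_def)
  ultimately show ?case
    by simp
qed simp

lemma foldr_lmult_lmult:
  assumes "reduced w"
  shows "foldr lmult (lmult a v) w = lmult a (foldr lmult v w)"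
proof (cases v)
  case (Cons b v')
  have "lmult a (b # v') = (if b = inv_letter a then v' else a # b # v')"
    by (simp add: lmult_def)
  with Cons show ?thesis
    using lmult_lmult_inv_letter[OF reduced_foldr_lmult[OF assms]] by simp
qed (simp add: lmult_def)

lemma foldr_lmult_assoc:
  "reduced w \<Longrightarrow> foldr lmult (foldr lmult u v) w = foldr lmult u (foldr lmult v w)"
  by (induction u) (simp_all add: foldr_lmult_lmult)

lemma foldr_lmult_inverse:
  "reduced v \<Longrightarrow> foldr lmult (rev (map inv_letter u)) (foldr lmult u v) = v"
  by (induction u arbitrary: v) (simp_all add: lmult_inv_letter_lmult reduced_foldr_lmult)

lemma reduced_inverse: "reduced u \<Longrightarrow> reduced (rev (map inv_letter u))"
proof -
  have *: "inv_letter a \<noteq> b \<longleftrightarrow> a \<noteq> inv_letter b" for a b :: "'a \<times> bool"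
    by auto
  show "reduced u \<Longrightarrow> ?thesis"
    by (simp add: reduced_def successively_map successively_rev *)
      (auto elim: successively_mono)
qed

typedef 'x free_group = "{w :: ('x \<times> bool) list. reduced w}"
  morphisms reduced_word Abs_free_group
  by (rule exI[of _ "[]"]) simp

setup_lifting type_definition_free_group

instantiation free_group :: (type) "{group_add, monoid_with_length}"
begin

lift_definition zero_free_group :: "'a free_group" is "[]"
  by simp

lift_definition plus_free_group :: "'a free_group \<Rightarrow> 'a free_group \<Rightarrow> 'a free_group"
  is "foldr lmult"
  by (rule reduced_foldr_lmult)

lift_definition uminus_free_group :: "'a free_group \<Rightarrow> 'a free_group"
  is "\<lambda>u. rev (map inv_letter u)"
  by (rule reduced_inverse)

definition minus_free_group :: "'a free_group \<Rightarrow> 'a free_group \<Rightarrow> 'a free_group"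
  where "u - v = u + - v" for u v :: "'a free_group"

lift_definition wlen_free_group :: "'a free_group \<Rightarrow> nat" is length .

instance
proof
  fix u v w :: "'a free_group"
  show "u + v + w = u + (v + w)"
    by transfer (rule foldr_lmult_assoc)
  show "0 + u = u"
    by transfer simp
  show "u + 0 = u"
    by transfer (rule foldr_lmult_Nil)
  show "- u + u = 0"
    by transfer (metis foldr_lmult_Nil foldr_lmult_inverse reduced_Nil)
  show "u + - v = u - v"
    by (simp add: minus_free_group_def)
qed

end

type_synonym ('x, 'k) free_algebra = "'x free_monoid \<Rightarrow>\<^sub>0 'k"
type_synonym ('x, 'k) free_group_algebra = "'x free_group \<Rightarrow>\<^sub>0 'k"


section \<open>Right modules\<close>

text \<open>
  As for \<^locale>\<open>Module.module\<close>, only the additive part of the underlying ring record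
  is relevant.
\<close>

record ('r, 'm) rmodule = "'m ring" +
  ract :: "'m \<Rightarrow> 'r \<Rightarrow> 'm" (infixl \<open>\<triangleleft>\<index>\<close> 70)

locale right_module = abelian_group M
  for M :: "('r::ring_1, 'm, 'z) rmodule_scheme" (structure) +
  assumes ract_closed [simp, intro]: "m \<in> carrier M \<Longrightarrow> m \<triangleleft> r \<in> carrier M"
    and ract_l_distr:
      "m \<in> carrier M \<Longrightarrow> m' \<in> carrier M \<Longrightarrow> (m \<oplus> m') \<triangleleft> r = m \<triangleleft> r \<oplus> m' \<triangleleft> r"
    and ract_r_distr: "m \<in> carrier M \<Longrightarrow> m \<triangleleft> (r + s) = m \<triangleleft> r \<oplus> m \<triangleleft> s"
    and ract_mult: "m \<in> carrier M \<Longrightarrow> m \<triangleleft> (r * s) = m \<triangleleft> r \<triangleleft> s"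
    and ract_one [simp]: "m \<in> carrier M \<Longrightarrow> m \<triangleleft> 1 = m"

locale right_submodule = subgroup N "add_monoid M"
  for N :: "'m set" and M :: "('r::ring_1, 'm, 'z) rmodule_scheme" (structure) +
  assumes ract_closed: "m \<in> N \<Longrightarrow> m \<triangleleft> r \<in> N"

definition regular_module :: "('r::ring_1, 'r) rmodule"
  where "regular_module =
    \<lparr>carrier = UNIV, mult = (*), one = 1, zero = 0, add = (+), ract = (*)\<rparr>"

definition quotient_module ::
    "('r::ring_1, 'm, 'z) rmodule_scheme \<Rightarrow> 'm set \<Rightarrow> ('r, 'm set) rmodule"
  where "quotient_module M N =
    \<lparr>carrier = a_rcosets\<^bsub>M\<^esub> N, mult = undefined, one = undefined, zero = N, add = set_add M,
     ract = (\<lambda>C r. \<Union>m\<in>C. N +>\<^bsub>M\<^esub> (m \<triangleleft>\<^bsub>M\<^esub> r))\<rparr>"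

text \<open>The submodule \<open>N\<close> regarded as a module in its own right.\<close>

abbreviation restrict_to ::
    "('r::ring_1, 'm, 'z) rmodule_scheme \<Rightarrow> 'm set \<Rightarrow> ('r, 'm, 'z) rmodule_scheme"
  where "restrict_to M N \<equiv> M\<lparr>carrier := N\<rparr>"

lemma right_module_regular: "right_module (regular_module :: ('r::ring_1, 'r) rmodule)"
proof -
  have "abelian_group (regular_module :: ('r, 'r) rmodule)"
    by (rule abelian_groupI) (auto simp: regular_module_def intro: exI[of _ "- _"] left_minus)
  then show ?thesis
    by (auto simp: right_module_def right_module_axioms_def regular_module_def algebra_simps)
qed

lemma right_module_restrict:
  fixes M (structure)
  assumes "right_module M" "right_submodule N M"
  shows "right_module (restrict_to M N)"
proof -
  interpret right_module M by fact
  interpret N: right_submodule N M by fact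
  have car: "x \<in> carrier M" if "x \<in> N" for x
    using N.subset that by auto
  have add: "x \<oplus> y \<in> N" if "x \<in> N" "y \<in> N" for x y
    using N.m_closed[OF that] by simp
  have zero: "\<zero> \<in> N"
    using N.one_closed by simp
  have neg: "\<ominus> x \<in> N" if "x \<in> N" for x
    using N.m_inv_closed[OF that] by (simp add: a_inv_def)
  have "abelian_group (restrict_to M N)"
  proof (rule abelian_groupI)
    fix x assume "x \<in> carrier (restrict_to M N)"
    then show "\<exists>y\<in>carrier (restrict_to M N). y \<oplus>\<^bsub>restrict_to M N\<^esub> x = \<zero>\<^bsub>restrict_to M N\<^esub>"
      using l_neg[OF car, of x] neg[of x] by auto
  qed (simp_all add: car add zero a_ac)
  then show ?thesis
    by (simp add: right_module_def right_module_axioms_def car N.ract_closed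
        ract_l_distr ract_r_distr ract_mult)
qed

lemma right_module_quotient:
  fixes M (structure)
  assumes "right_module M" "right_submodule N M"
  shows "right_module (quotient_module M N)"
proof -
  interpret right_module M by fact
  interpret N: right_submodule N M by fact
  interpret ab: abelian_subgroup N M
    by (rule abelian_subgroupI3) (use N.subgroup_axioms abelian_group_axioms in \<open>auto intro: additive_subgroup.intro\<close>)
  have act: "(\<Union>m'\<in>N +> m. N +> (m' \<triangleleft> r)) = N +> (m \<triangleleft> r)" if m: "m \<in> carrier M" for m r
  proof -
    have "N +> (m' \<triangleleft> r) = N +> (m \<triangleleft> r)" if "m' \<in> N +> m" for m'
    proof -
      from that obtain h where h: "h \<in> N" "m' = h \<oplus> m" by (auto simp: a_r_coset_def r_coset_def)
      have hc: "h \<in> carrier M" using h N.subset by auto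
      then have "m' \<triangleleft> r = h \<triangleleft> r \<oplus> m \<triangleleft> r" using h m by (simp add: ract_l_distr)
      moreover have "h \<triangleleft> r \<in> N" using N.ract_closed h by blast
      ultimately have "m' \<triangleleft> r \<in> N +> (m \<triangleleft> r)" by (auto simp: a_r_coset_def r_coset_def)
      then show ?thesis using a_repr_independence[of "m' \<triangleleft> r" N "m \<triangleleft> r"] m N.subgroup_axioms by simp
    qed
    then show ?thesis using ab.a_rcos_self[OF m] by blast
  qed
  have ex: "\<exists>m\<in>carrier M. C = N +> m" if "C \<in> a_rcosets N" for C
    using that by (auto simp: A_RCOSETS_def' a_r_coset_def')
  have mem: "N +> m \<in> a_rcosets N" if "m \<in> carrier M" for m
    using that by (auto simp: A_RCOSETS_def RCOSETS_def a_r_coset_def)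
  have N0: "N +> \<zero> = N"
    using ab.a_subset by (simp add: a_coset_add_zero)
  have "abelian_group (quotient_module M N)"
  proof (rule abelian_groupI)
    show "\<zero>\<^bsub>quotient_module M N\<^esub> \<in> carrier (quotient_module M N)"
      using mem[of \<zero>] N0 by (simp add: quotient_module_def)
  next
    fix C assume "C \<in> carrier (quotient_module M N)"
    then obtain m where m: "m \<in> carrier M" "C = N +> m"
      by (auto simp: quotient_module_def dest: ex)
    show "\<zero>\<^bsub>quotient_module M N\<^esub> \<oplus>\<^bsub>quotient_module M N\<^esub> C = C"
      using m ab.a_rcos_sum[of \<zero> m] N0 by (simp add: quotient_module_def)
    show "\<exists>D\<in>carrier (quotient_module M N). D \<oplus>\<^bsub>quotient_module M N\<^esub> C = \<zero>\<^bsub>quotient_module M N\<^esub>"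
      using m ab.a_rcos_sum[of "\<ominus> m" m] N0 mem[of "\<ominus> m"]
      by (auto simp: quotient_module_def l_neg intro!: bexI[of _ "N +> \<ominus> m"])
  next
    fix C D assume "C \<in> carrier (quotient_module M N)" "D \<in> carrier (quotient_module M N)"
    then obtain m m' where m: "m \<in> carrier M" "C = N +> m" "m' \<in> carrier M" "D = N +> m'"
      by (auto simp: quotient_module_def dest!: ex)
    then show "C \<oplus>\<^bsub>quotient_module M N\<^esub> D = D \<oplus>\<^bsub>quotient_module M N\<^esub> C"
      by (simp add: quotient_module_def ab.a_rcos_sum a_comm)
  qed (auto simp: quotient_module_def dest!: ex simp: mem ab.a_rcos_sum a_assoc)
  then show ?thesis
  proof (rule right_module.intro, unfold_locales)
    fix C r s assume "C \<in> carrier (quotient_module M N)"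
    then obtain m where m: "m \<in> carrier M" "C = N +> m"
      by (auto simp: quotient_module_def dest!: ex)
    show "C \<triangleleft>\<^bsub>quotient_module M N\<^esub> r \<in> carrier (quotient_module M N)"
      using m by (simp add: quotient_module_def act mem)
    show "C \<triangleleft>\<^bsub>quotient_module M N\<^esub> (r + s) =
        C \<triangleleft>\<^bsub>quotient_module M N\<^esub> r \<oplus>\<^bsub>quotient_module M N\<^esub> C \<triangleleft>\<^bsub>quotient_module M N\<^esub> s"
      using m by (simp add: quotient_module_def act ab.a_rcos_sum ract_r_distr)
    show "C \<triangleleft>\<^bsub>quotient_module M N\<^esub> (r * s) =
        C \<triangleleft>\<^bsub>quotient_module M N\<^esub> r \<triangleleft>\<^bsub>quotient_module M N\<^esub> s"
      using m by (simp add: quotient_module_def act ract_mult)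
    show "C \<triangleleft>\<^bsub>quotient_module M N\<^esub> 1 = C"
      using m by (simp add: quotient_module_def act)
  next
    fix C D r assume "C \<in> carrier (quotient_module M N)" "D \<in> carrier (quotient_module M N)"
    then obtain m m' where m: "m \<in> carrier M" "C = N +> m" "m' \<in> carrier M" "D = N +> m'"
      by (auto simp: quotient_module_def dest!: ex)
    then show "(C \<oplus>\<^bsub>quotient_module M N\<^esub> D) \<triangleleft>\<^bsub>quotient_module M N\<^esub> r =
        C \<triangleleft>\<^bsub>quotient_module M N\<^esub> r \<oplus>\<^bsub>quotient_module M N\<^esub> D \<triangleleft>\<^bsub>quotient_module M N\<^esub> r"
      by (simp add: quotient_module_def act ab.a_rcos_sum ract_l_distr)
  qed
qed

definition generates :: "('r::ring_1, 'm, 'z) rmodule_scheme \<Rightarrow> 'm set \<Rightarrow> bool"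
  where "generates M A \<longleftrightarrow> A \<subseteq> carrier M \<and> (\<lambda>N. right_submodule N M) hull A = carrier M"


section \<open>Growth\<close>

text \<open>
  A module over the algebra \<open>'g \<Rightarrow>\<^sub>0 'k\<close> as a vector space over the field \<open>'k\<close>, where the
  scalar \<open>c\<close> acts through the element \<open>c \<sqdot> 1\<close> of the algebra.
\<close>

definition scalar_space ::
    "('g::monoid_add \<Rightarrow>\<^sub>0 'k::field, 'm, 'z) rmodule_scheme \<Rightarrow> ('k, 'm) module"
  where "scalar_space M =
    \<lparr>carrier = carrier M, mult = mult M, one = one M, zero = zero M, add = add M,
     smult = (\<lambda>c m. m \<triangleleft>\<^bsub>M\<^esub> Poly_Mapping.single 0 c)\<rparr>"

lemma vectorspace_scalar_space:
  fixes M :: "('g::monoid_add \<Rightarrow>\<^sub>0 'k::field, 'm, 'z) rmodule_scheme"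
  assumes "right_module M"
  shows "vectorspace (class_ring :: 'k ring) (scalar_space M)"
proof -
  interpret right_module M by fact
  have "abelian_group (scalar_space M)"
    by (rule abelian_groupI) (auto simp: scalar_space_def a_assoc a_comm a_lcomm intro: l_neg)
  moreover have F: "field (class_ring :: 'k ring)"
    by (rule class_field.field_axioms)
  moreover have "cring (class_ring :: 'k ring)"
    using F by (simp add: field_def domain_def)
  moreover have "Poly_Mapping.single (0::'g) (a * b :: 'k) = Poly_Mapping.single 0 b * Poly_Mapping.single 0 a" for a b
    by (simp add: mult_single mult.commute)
  ultimately show ?thesis
    by (auto simp: vectorspace_def Module.module_def module_axioms_def 
     scalar_space_def single_add ract_l_distr ract_r_distr ract_mult)
qed

definition linear_span ::
    "('g::monoid_add \<Rightarrow>\<^sub>0 'k::field, 'm, 'z) rmodule_scheme \<Rightarrow> 'm set \<Rightarrow> 'm set"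
  where "linear_span M S = LinearCombinations.module.span (class_ring :: 'k ring) (scalar_space M) S"

definition linear_dim ::
    "('g::monoid_add \<Rightarrow>\<^sub>0 'k::field, 'm, 'z) rmodule_scheme \<Rightarrow> 'm set \<Rightarrow> nat"
  where "linear_dim M V = vectorspace.dim (class_ring :: 'k ring) ((scalar_space M)\<lparr>carrier := V\<rparr>)"

definition ball_span :: "nat \<Rightarrow> ('g::monoid_with_length \<Rightarrow>\<^sub>0 'k::field) set"
  where "ball_span n =
    linear_span regular_module {Poly_Mapping.single g 1 | g. wlen g \<le> n}"

definition growth ::
    "('g::monoid_with_length \<Rightarrow>\<^sub>0 'k::field, 'm, 'z) rmodule_scheme \<Rightarrow> 'm set \<Rightarrow> nat \<Rightarrow> nat"
  where "growth M A n =
    linear_dim M (linear_span M {a \<triangleleft>\<^bsub>M\<^esub> p | a p. a \<in> A \<and> p \<in> ball_span n})"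

definition growth_equiv :: "(nat \<Rightarrow> nat) \<Rightarrow> (nat \<Rightarrow> nat) \<Rightarrow> bool"
  where "growth_equiv f g \<longleftrightarrow>
    (\<exists>C C'. \<forall>n. f n \<le> g (n + C) \<and> g n \<le> f (n + C'))"

text \<open>
  Maximal growth of a finitely generated module. The comparison function is the
  growth function of the free module of rank 1 with its generating set \<open>{1}\<close>, that is,
  the dimension of \<^term>\<open>ball_span n\<close>. Since growth functions for different finite
  generating sets are equivalent, it does not matter which one is used.
\<close>

definition fg_maximal_growth ::
    "('g::monoid_with_length \<Rightarrow>\<^sub>0 'k::field, 'm, 'z) rmodule_scheme \<Rightarrow> bool"
  where "fg_maximal_growth M \<longleftrightarrow>
    (\<exists>A. finite A \<and> generates M A \<and>
      growth_equiv (growth M A)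
        (growth (regular_module :: ('g \<Rightarrow>\<^sub>0 'k, 'g \<Rightarrow>\<^sub>0 'k) rmodule) {1}))"

definition maximal_growth ::
    "('g::monoid_with_length \<Rightarrow>\<^sub>0 'k::field, 'm, 'z) rmodule_scheme \<Rightarrow> bool"
  where "maximal_growth M \<longleftrightarrow>
    (\<exists>V. right_submodule V M \<and> fg_maximal_growth (restrict_to M V))"

definition no_maximal_growth ::
    "('g::monoid_with_length \<Rightarrow>\<^sub>0 'k::field, 'm, 'z) rmodule_scheme \<Rightarrow> bool"
  where "no_maximal_growth M \<longleftrightarrow>
    right_module M \<and> (\<nexists>V. right_submodule V M \<and> maximal_growth (restrict_to M V))"

end

theory Submission
  imports Defs
begin

text \<open>
  Let \<open>B(n)\<close> be the ball of radius \<open>n\<close> in the free monoid or group; then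
  \<open>B(k + j) = B(k) B(j)\<close>, and \<open>|B(n)|\<close> equals \<open>p\<^sup>n\<close> up to a constant factor for some
  \<open>p \<ge> 2\<close>. Suppose that a finite set \<open>A \<subseteq> M\<close> generates a module of maximal growth and that
  \<open>M/N\<close> is not of maximal growth. Then for some \<open>k\<close> the image of \<open>A B(k)\<close> in \<open>M/N\<close> has dimension
  \<open>d\<close> much smaller than \<open>p\<^sup>k\<close>. Lifting \<open>d\<close> spanning vectors to a set \<open>T\<close>, and correcting the
  elements of \<open>A B(k)\<close> by linear combinations of \<open>T\<close>, one finds a finite set \<open>D \<subseteq> N\<close> such that
  \<open>A B(k)\<close> and \<open>D \<union> T\<close> have the same span. Hence \<open>A B(k + j)\<close> and \<open>D B(j) \<union> T B(j)\<close> have the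
  same span for all \<open>j\<close>, and as \<open>T B(j)\<close> contributes at most \<open>d |B(j)|\<close>, a small fraction of
  \<open>p\<^sup>k\<^sup>+\<^sup>j\<close>, the submodule of \<open>N\<close> generated by \<open>D\<close> has maximal growth.
\<close>

section \<open>Linear spans and dimensions\<close>

text \<open>Subspaces in terms of \<open>M\<close> itself, with scalars acting as ring elements;
  negation is the scalar -1. By \<open>submodule_scalar_space_iff\<close> they are the submodules of
  \<open>scalar_space M\<close>.\<close>

definition linear_subspace ::
    "('g::monoid_add \<Rightarrow>\<^sub>0 'k::field, 'm, 'z) rmodule_scheme \<Rightarrow> 'm set \<Rightarrow> bool"
  where "linear_subspace M W \<longleftrightarrow>
    W \<subseteq> carrier M \<and> \<zero>\<^bsub>M\<^esub> \<in> W \<and> (\<forall>x\<in>W. \<forall>y\<in>W. x \<oplus>\<^bsub>M\<^esub> y \<in> W) \<and>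
    (\<forall>x\<in>W. \<forall>c. x \<triangleleft>\<^bsub>M\<^esub> Poly_Mapping.single 0 c \<in> W)"

lemma module_scalar_space:
  fixes M :: "('g::monoid_add \<Rightarrow>\<^sub>0 'k::field, 'm, 'z) rmodule_scheme"
  shows "right_module M \<Longrightarrow> Module.module (class_ring :: 'k ring) (scalar_space M)"
  using vectorspace_scalar_space by (auto simp: vectorspace_def)

lemma scalar_space_restrict:
  "scalar_space (restrict_to M V) = (scalar_space M)\<lparr>carrier := V\<rparr>"
  by (simp add: scalar_space_def)

lemma submodule_scalar_space_iff:
  fixes M :: "('g::monoid_add \<Rightarrow>\<^sub>0 'k::field, 'm, 'z) rmodule_scheme"
  assumes "right_module M"
  shows "LinearCombinations.submodule (class_ring :: 'k ring) W (scalar_space M) \<longleftrightarrow>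
    linear_subspace M W"
  using module_scalar_space[OF assms]
  by (auto simp: LinearCombinations.submodule_def linear_subspace_def scalar_space_def class_ring_simps)

lemma linear_subspace_span:
  assumes "right_module M" "S \<subseteq> carrier M"
  shows "linear_subspace M (linear_span M S)"
  using LinearCombinations.module.span_is_submodule[OF module_scalar_space[OF assms(1)]] assms
  by (simp add: linear_span_def submodule_scalar_space_iff[symmetric] scalar_space_def)

lemma linear_span_superset:
  assumes "right_module M" "S \<subseteq> carrier M"
  shows "S \<subseteq> linear_span M S"
  using LinearCombinations.module.in_own_span[OF module_scalar_space[OF assms(1)]] assms
  by (simp add: linear_span_def scalar_space_def)

lemma linear_span_minimal:
  assumes "right_module M" "linear_subspace M W" "S \<subseteq> W"
  shows "linear_span M S \<subseteq> W"
  using LinearCombinations.module.span_is_subset[OF module_scalar_space[OF assms(1)]] assms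
  by (simp add: linear_span_def submodule_scalar_space_iff)

lemma linear_span_closed:
  assumes "right_module M" "S \<subseteq> carrier M"
  shows "linear_span M S \<subseteq> carrier M"
  using linear_subspace_span[OF assms] by (simp add: linear_subspace_def)

lemma linear_span_mono:
  assumes "right_module M" "T \<subseteq> carrier M" "S \<subseteq> linear_span M T"
  shows "linear_span M S \<subseteq> linear_span M T"
  using assms by (intro linear_span_minimal linear_subspace_span)

lemma linear_span_eqI:
  assumes "right_module M" "S \<subseteq> linear_span M T" "T \<subseteq> linear_span M S"
    "S \<subseteq> carrier M" "T \<subseteq> carrier M"
  shows "linear_span M S = linear_span M T"
  using assms by (intro equalityI linear_span_mono)

lemma linear_subspace_right_submodule:
  fixes M (structure)
  assumes "right_submodule V M"
  shows "linear_subspace M V"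
proof -
  interpret right_submodule V M by fact
  show ?thesis
    using subset m_closed one_closed by (auto simp: linear_subspace_def ract_closed)
qed

lemma linear_span_restrict:
  assumes "right_module M" "right_submodule V M" "S \<subseteq> V"
  shows "linear_span (restrict_to M V) S = linear_span M S"
  using LinearCombinations.module.span_li_not_depend(1)[OF module_scalar_space[OF assms(1)]] assms
  by (simp add: linear_span_def scalar_space_restrict submodule_scalar_space_iff
      linear_subspace_right_submodule)

lemma linear_dim_restrict: "linear_dim (restrict_to M V) W = linear_dim M W"
  by (simp add: linear_dim_def scalar_space_restrict)

lemma vectorspace_linear_subspace:
  fixes M :: "('g::monoid_add \<Rightarrow>\<^sub>0 'k::field, 'm, 'z) rmodule_scheme"
  assumes "right_module M" "linear_subspace M W"
  shows "vectorspace (class_ring :: 'k ring) ((scalar_space M)\<lparr>carrier := W\<rparr>)"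
  using vectorspace.subspace_is_vs[OF vectorspace_scalar_space[OF assms(1)]] assms
  by (simp add: subspace_def submodule_scalar_space_iff vectorspace_scalar_space)

lemma span_linear_subspace:
  fixes M :: "('g::monoid_add \<Rightarrow>\<^sub>0 'k::field, 'm, 'z) rmodule_scheme"
  assumes "right_module M" "linear_subspace M W" "S \<subseteq> W"
  shows "LinearCombinations.module.span (class_ring :: 'k ring) ((scalar_space M)\<lparr>carrier := W\<rparr>) S =
    linear_span M S"
  using LinearCombinations.module.span_li_not_depend(1)[OF module_scalar_space[OF assms(1)]] assms
  by (simp add: linear_span_def submodule_scalar_space_iff)

lemma linear_dim_span_le:
  assumes M: "right_module M" and "finite S" "S \<subseteq> carrier M"
  shows "linear_dim M (linear_span M S) \<le> card S"
proof -
  note W = linear_subspace_span[OF M assms(3)]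
  show ?thesis
    using vectorspace.gen_ge_dim[OF vectorspace_linear_subspace[OF M W], of S] assms
    by (simp add: linear_dim_def span_linear_subspace[OF M W] linear_span_superset)
qed

text \<open>The dimension is defined as the least size of a finite spanning set, and
  \<open>S\<close> shows that such sets exist, so the minimum is attained.\<close>

lemma linear_span_minimal_generators:
  assumes M: "right_module M" and "finite S" "S \<subseteq> carrier M"
  obtains T where "finite T" "T \<subseteq> linear_span M S" "card T = linear_dim M (linear_span M S)"
    "linear_span M T = linear_span M S"
proof -
  let ?W = "linear_span M S"
  let ?P = "\<lambda>n. \<exists>T. finite T \<and> card T = n \<and> T \<subseteq> ?W \<and> linear_span M T = ?W"
  note W = linear_subspace_span[OF M assms(3)]
  have "linear_dim M ?W = (LEAST n. ?P n)"
    unfolding linear_dim_def vectorspace.dim_def[OF vectorspace_linear_subspace[OF M W]]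
    by (rule arg_cong[where f = Least]) (auto simp: span_linear_subspace[OF M W] fun_eq_iff)
  moreover have "?P (LEAST n. ?P n)"
    by (rule LeastI[of ?P "card S"]) (use assms linear_span_superset[OF M] in blast)
  ultimately show thesis
    using that by auto
qed

text \<open>A spanning set \<open>S'\<close> of minimal size replaces \<open>S\<close>; then
  counting \<open>S' \<union> T\<close> bounds the dimension.\<close>

lemma linear_dim_union_le:
  assumes M: "right_module M" and S: "finite S" "S \<subseteq> carrier M" and T: "finite T" "T \<subseteq> carrier M"
  shows "linear_dim M (linear_span M (S \<union> T)) \<le> linear_dim M (linear_span M S) + card T"
proof -
  obtain S' where S': "finite S'" "S' \<subseteq> linear_span M S"
    "card S' = linear_dim M (linear_span M S)" "linear_span M S' = linear_span M S"
    using linear_span_minimal_generators[OF M S] .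
  have car: "S' \<subseteq> carrier M"
    using S' linear_span_closed[OF M S(2)] by blast
  have "linear_span M S \<subseteq> linear_span M (S \<union> T)"
    by (rule linear_span_mono[OF M]) (use S T linear_span_superset[OF M, of "S \<union> T"] in auto)
  moreover have "linear_span M S' \<subseteq> linear_span M (S' \<union> T)"
    by (rule linear_span_mono[OF M]) (use car T linear_span_superset[OF M, of "S' \<union> T"] in auto)
  ultimately have "linear_span M (S \<union> T) = linear_span M (S' \<union> T)"
    using S' S T car linear_span_superset[OF M, of "S \<union> T"] linear_span_superset[OF M, of "S' \<union> T"]
      linear_span_superset[OF M S(2)] by (intro linear_span_eqI[OF M]) auto
  then have "linear_dim M (linear_span M (S \<union> T)) \<le> card (S' \<union> T)"
    using linear_dim_span_le[OF M, of "S' \<union> T"] S' T car by simp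
  also have "\<dots> \<le> card S' + card T"
    by (rule card_Un_le)
  finally show ?thesis
    by (simp add: S')
qed

section \<open>Linear independence of monoid elements in the monoid algebra\<close>

definition singles :: "'g set \<Rightarrow> ('g \<Rightarrow>\<^sub>0 'k::field) set"
  where "singles G = (\<lambda>g. Poly_Mapping.single g 1) ` G"

lemma inj_single_one: "inj (\<lambda>g. Poly_Mapping.single g (1::'k::field))"
  by (rule injI) (metis lookup_single_eq lookup_single_not_eq one_neq_zero)

text \<open>Distinct monoid elements are linearly independent, hence a basis of their span. Applied
  to balls, this gives the growth of the free module of rank 1.\<close>

lemma linear_dim_singles:
  fixes G :: "'g::monoid_add set"
  defines "R \<equiv> regular_module :: ('g \<Rightarrow>\<^sub>0 'k::field, 'g \<Rightarrow>\<^sub>0 'k) rmodule"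
  assumes "finite G"
  shows "linear_dim R (linear_span R (singles G)) = card G"
proof -
  let ?K = "class_ring :: 'k ring"
  let ?V = "scalar_space R"
  let ?W = "linear_span R (singles G)"
  have R: "right_module R"
    unfolding R_def by (rule right_module_regular)
  have car: "carrier ?V = UNIV" "carrier R = UNIV"
    by (simp_all add: R_def regular_module_def scalar_space_def)
  interpret V: vectorspace ?K ?V
    by (rule vectorspace_scalar_space[OF R])
  \<comment> \<open>The scalar \<open>c\<close> acts as right multiplication by
    \<open>single 0 c\<close>, so linear combinations become plain sums in the algebra.\<close>
  have lincomb: "V.lincomb a A = (\<Sum>v\<in>A. v * Poly_Mapping.single 0 (a v))" if "finite A" for a A
    using that
  proof induction
    case empty
    show ?case
      by (simp add: V.lincomb_def) (simp add: scalar_space_def R_def regular_module_def)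
  next
    case (insert x A)
    then show ?case
      by (simp add: V.lincomb_def car V.finsum_insert Pi_def)
         (simp add: scalar_space_def R_def regular_module_def)
  qed
  have "\<not> V.lin_dep (singles G)"
  proof (rule V.finite_lin_indpt2)
    fix a assume *: "V.lincomb a (singles G) = \<zero>\<^bsub>?V\<^esub>"
    have zero: "\<zero>\<^bsub>?V\<^esub> = 0"
      by (simp add: scalar_space_def R_def regular_module_def)
    have inj: "inj_on (\<lambda>g. Poly_Mapping.single g (1::'k)) G"
      using inj_single_one by (rule inj_on_subset) simp
    have "a (Poly_Mapping.single g 1) = 0" if g: "g \<in> G" for g
    proof -
      have "0 = (\<Sum>h\<in>G. Poly_Mapping.single h 1 * Poly_Mapping.single 0 (a (Poly_Mapping.single h 1)))"
        using * assms(2) unfolding zero by (simp add: lincomb singles_def sum.reindex[OF inj])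
      \<comment> \<open>Taking the coefficient at \<open>g\<close> isolates the scalar attached to
        \<open>g\<close>.\<close>
      then have "0 = Poly_Mapping.lookup (\<Sum>h\<in>G. Poly_Mapping.single h (a (Poly_Mapping.single h 1))) g"
        by (simp add: mult_single)
      also have "\<dots> = (\<Sum>h\<in>G. if h = g then a (Poly_Mapping.single h 1) else 0)"
        by (simp add: Poly_Mapping.lookup_sum lookup_single when_def)
      also have "\<dots> = a (Poly_Mapping.single g 1)"
        using assms g by simp
      finally show ?thesis
        by simp
    qed
    then show "\<forall>v\<in>singles G. a v = \<zero>\<^bsub>?K\<^esub>"
      by (auto simp: singles_def class_ring_simps)
  qed (use assms car in \<open>auto simp: singles_def\<close>)
  \<comment> \<open>Independence carries over to the span regarded as a vector space of its own,
    where \<open>singles G\<close> also generates.\<close>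
  then have "\<not> LinearCombinations.module.lin_dep ?K (?V\<lparr>carrier := ?W\<rparr>) (singles G)"
    using LinearCombinations.module.span_li_not_depend(2)[OF V.module_axioms, of "singles G" ?W]
      linear_span_superset[OF R] linear_subspace_span[OF R] car submodule_scalar_space_iff[OF R] by simp
  moreover have W: "linear_subspace R ?W" "singles G \<subseteq> ?W"
    using linear_subspace_span[OF R] linear_span_superset[OF R] car by auto
  ultimately have "vectorspace.basis ?K (?V\<lparr>carrier := ?W\<rparr>) (singles G)"
    by (simp add: vectorspace.basis_def[OF vectorspace_linear_subspace[OF R W(1)]]
        span_linear_subspace[OF R W])
  then have "linear_dim R ?W = card (singles G :: ('g \<Rightarrow>\<^sub>0 'k) set)"
    using vectorspace.dim_basis[OF vectorspace_linear_subspace[OF R W(1)], of "singles G"] assms(2)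
    by (simp add: linear_dim_def singles_def)
  also have "\<dots> = card G"
    unfolding singles_def by (intro card_image inj_on_subset[OF inj_single_one]) simp
  finally show ?thesis .
qed

section \<open>Growth functions\<close>

lemma (in right_module) ract_zero [simp]: "\<zero> \<triangleleft> r = \<zero>"
  using ract_l_distr[of \<zero> \<zero> r] by (metis ract_closed add.r_cancel_one' l_zero zero_closed)

lemma (in right_module) ract_ring_zero: "m \<in> carrier M \<Longrightarrow> m \<triangleleft> 0 = \<zero>"
  using ract_r_distr[of m 0 0] by (metis add.r_cancel_one' add_0 ract_closed)

lemma (in right_module) ract_minus_one: "m \<in> carrier M \<Longrightarrow> m \<triangleleft> (- 1) \<oplus> m = \<zero>"
  using ract_r_distr[of m "- 1" 1] by (simp add: ract_ring_zero)

section \<open>Translates of sets of vectors by balls\<close>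

definition word_ball :: "nat \<Rightarrow> 'g::monoid_with_length set"
  where "word_ball n = {g. wlen g \<le> n}"

definition translates ::
    "('g::monoid_add \<Rightarrow>\<^sub>0 'k::field, 'm, 'z) rmodule_scheme \<Rightarrow> 'm set \<Rightarrow> 'g set \<Rightarrow> 'm set"
  where "translates M S G = (\<lambda>(s, g). s \<triangleleft>\<^bsub>M\<^esub> Poly_Mapping.single g 1) ` (S \<times> G)"

lemma translates_closed:
  "right_module M \<Longrightarrow> S \<subseteq> carrier M \<Longrightarrow> translates M S G \<subseteq> carrier M"
  by (auto simp: translates_def intro!: right_module.ract_closed)

lemma finite_translates: "finite S \<Longrightarrow> finite G \<Longrightarrow> finite (translates M S G)"
  by (simp add: translates_def)

lemma card_translates_le: "finite S \<Longrightarrow> finite G \<Longrightarrow> card (translates M S G) \<le> card S * card G"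
  unfolding translates_def by (metis card_cartesian_product card_image_le finite_cartesian_product)

text \<open>Acting by \<open>g\<close> is linear, so the vectors sent into the span of the
  translates form a subspace, and this subspace contains \<open>S\<close>.\<close>

lemma ract_linear_span:
  fixes M (structure)
  assumes "right_module M" "S \<subseteq> carrier M" "x \<in> linear_span M S" "g \<in> G"
  shows "x \<triangleleft> Poly_Mapping.single g 1 \<in> linear_span M (translates M S G)"
proof -
  interpret right_module M by fact
  let ?T = "linear_span M (translates M S G)"
  have T: "linear_subspace M ?T" "translates M S G \<subseteq> ?T"
    using assms by (simp_all add: linear_subspace_span linear_span_superset translates_closed)
  have "linear_subspace M {x \<in> carrier M. x \<triangleleft> Poly_Mapping.single g 1 \<in> ?T}"
    unfolding linear_subspace_def
  proof (intro conjI ballI allI)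
    fix x c assume x: "x \<in> {x \<in> carrier M. x \<triangleleft> Poly_Mapping.single g 1 \<in> ?T}"
    \<comment> \<open>Scalars commute with \<open>g\<close>: both products in the algebra equal
      \<open>single g c\<close>.\<close>
    have "x \<triangleleft> Poly_Mapping.single 0 c \<triangleleft> Poly_Mapping.single g 1 =
        x \<triangleleft> Poly_Mapping.single g 1 \<triangleleft> Poly_Mapping.single 0 c"
      using x by (simp add: ract_mult[symmetric] mult_single)
    then show "x \<triangleleft> Poly_Mapping.single 0 c \<in> {x \<in> carrier M. x \<triangleleft> Poly_Mapping.single g 1 \<in> ?T}"
      using x T by (auto simp: linear_subspace_def)
  qed (use T in \<open>auto simp: linear_subspace_def ract_l_distr\<close>)
  moreover have "S \<subseteq> {x \<in> carrier M. x \<triangleleft> Poly_Mapping.single g 1 \<in> ?T}"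
    using T assms by (auto simp: translates_def)
  ultimately show ?thesis
    using linear_span_minimal[OF assms(1)] assms(3) by blast
qed

lemma translates_linear_span:
  "right_module M \<Longrightarrow> S \<subseteq> carrier M \<Longrightarrow> T \<subseteq> linear_span M S \<Longrightarrow>
    translates M T G \<subseteq> linear_span M (translates M S G)"
  using ract_linear_span[of M S] by (fastforce simp: translates_def)

lemma translates_translates:
  fixes M (structure)
  assumes "right_module M" "S \<subseteq> carrier M"
  shows "translates M (translates M S G) H = translates M S {g + h | g h. g \<in> G \<and> h \<in> H}"
proof -
  interpret right_module M by fact
  have *: "s \<triangleleft> Poly_Mapping.single g 1 \<triangleleft> Poly_Mapping.single h 1 = s \<triangleleft> Poly_Mapping.single (g + h) 1"
    if "s \<in> S" for s g h
    using that assms by (subst ract_mult[symmetric]) (auto simp: mult_single)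
  show ?thesis
    using * by (fastforce simp: translates_def image_iff)
qed

text \<open>For fixed \<open>a\<close> the map \<open>p \<mapsto> a \<triangleleft> p\<close> is
  linear, so \<open>p\<close> may be restricted to the monoid elements that span
  \<open>ball_span n\<close>.\<close>

lemma growth_eq:
  fixes M :: "('g::monoid_with_length \<Rightarrow>\<^sub>0 'k::field, 'm, 'z) rmodule_scheme" (structure)
  assumes "right_module M" "A \<subseteq> carrier M"
  shows "growth M A n = linear_dim M (linear_span M (translates M A (word_ball n)))"
proof -
  interpret right_module M by fact
  let ?R = "regular_module :: ('g \<Rightarrow>\<^sub>0 'k, 'g \<Rightarrow>\<^sub>0 'k) rmodule"
  let ?S = "{Poly_Mapping.single g 1 | g. wlen g \<le> n} :: ('g \<Rightarrow>\<^sub>0 'k) set"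
  let ?T = "linear_span M (translates M A (word_ball n))"
  have T: "linear_subspace M ?T" "translates M A (word_ball n) \<subseteq> ?T"
    using assms by (simp_all add: linear_subspace_span linear_span_superset translates_closed)
  have R: "carrier ?R = UNIV"
    by (simp add: regular_module_def)
  have "a \<triangleleft> p \<in> ?T" if a: "a \<in> A" and p: "p \<in> ball_span n" for a p
  proof -
    have a': "a \<in> carrier M"
      using a assms by auto
    have "linear_subspace ?R {p. a \<triangleleft> p \<in> ?T}"
      using T a' unfolding linear_subspace_def
      by (auto simp: regular_module_def ract_ring_zero ract_r_distr ract_mult)
    moreover have "?S \<subseteq> {p. a \<triangleleft> p \<in> ?T}"
      using T a by (auto simp: translates_def word_ball_def)
    ultimately have "ball_span n \<subseteq> {p. a \<triangleleft> p \<in> ?T}"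
      unfolding ball_span_def by (rule linear_span_minimal[OF right_module_regular])
    with p show ?thesis
      by blast
  qed
  moreover have "?S \<subseteq> ball_span n"
    unfolding ball_span_def by (rule linear_span_superset[OF right_module_regular]) (simp add: R)
  then have "translates M A (word_ball n) \<subseteq> {a \<triangleleft> p | a p. a \<in> A \<and> p \<in> ball_span n}"
    by (auto simp: translates_def word_ball_def)
  moreover have "{a \<triangleleft> p | a p. a \<in> A \<and> p \<in> ball_span n} \<subseteq> carrier M"
    using assms(2) by auto
  ultimately have "linear_span M {a \<triangleleft> p | a p. a \<in> A \<and> p \<in> ball_span n} = ?T"
    using linear_span_superset[OF assms(1), of "{a \<triangleleft> p | a p. a \<in> A \<and> p \<in> ball_span n}"]
    by (intro linear_span_eqI assms translates_closed) auto
  then show ?thesis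
    by (simp add: growth_def)
qed

lemma growth_regular:
  assumes "finite (word_ball n :: 'g::monoid_with_length set)"
  shows "growth (regular_module :: ('g \<Rightarrow>\<^sub>0 'k::field, 'g \<Rightarrow>\<^sub>0 'k) rmodule) {1} n =
    card (word_ball n :: 'g set)"
proof -
  let ?R = "regular_module :: ('g \<Rightarrow>\<^sub>0 'k, 'g \<Rightarrow>\<^sub>0 'k) rmodule"
  have "translates ?R {1} (word_ball n) = singles (word_ball n)"
    by (force simp: translates_def singles_def regular_module_def)
  moreover have "{1} \<subseteq> carrier ?R"
    by (simp add: regular_module_def)
  ultimately show ?thesis
    using linear_dim_singles[OF assms] growth_eq[OF right_module_regular, of "{1}" n] by metis
qed

text \<open>Spans and dimensions of subsets of \<open>V\<close> are the same in \<open>V\<close> and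
  in \<open>M\<close>, so the growth of a submodule can be computed in the ambient module.\<close>

lemma growth_restrict:
  assumes "right_module M" "right_submodule V M" "A \<subseteq> V"
  shows "growth (restrict_to M V) A n = growth M A n"
proof -
  have V: "V \<subseteq> carrier M"
    using linear_subspace_right_submodule[OF assms(2)] by (simp add: linear_subspace_def)
  have "translates (restrict_to M V) A (word_ball n) = translates M A (word_ball n)"
    by (simp add: translates_def)
  moreover have "translates M A (word_ball n) \<subseteq> V"
    using assms by (auto simp: translates_def intro!: right_submodule.ract_closed)
  ultimately show ?thesis
    using assms V growth_eq[OF assms(1), of A] growth_eq[OF right_module_restrict[OF assms(1,2)], of A]
    by (auto simp: linear_dim_restrict linear_span_restrict)
qed

section \<open>Submodules and generated submodules\<close>

lemma right_submodule_iff: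
  fixes M (structure)
  assumes "right_module M"
  shows "right_submodule V M \<longleftrightarrow> V \<subseteq> carrier M \<and> \<zero> \<in> V \<and> (\<forall>x\<in>V. \<forall>y\<in>V. x \<oplus> y \<in> V) \<and>
    (\<forall>x\<in>V. \<forall>r. x \<triangleleft> r \<in> V)" (is "?L \<longleftrightarrow> ?R")
proof
  assume ?L
  then interpret right_submodule V M .
  show ?R
    using subset m_closed one_closed by (auto simp: ract_closed)
next
  interpret right_module M by fact
  assume R: ?R
  have "inv\<^bsub>add_monoid M\<^esub> x \<in> V" if x: "x \<in> V" for x
  proof -
    have x': "x \<in> carrier M"
      using R x by auto
    \<comment> \<open>Closure under the ring action thus supplies the additive inverses.\<close>
    have "\<ominus> x = x \<triangleleft> (- 1)"
      using x' ract_minus_one by (intro minus_equality) auto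
    then show ?thesis
      using R x by (auto simp: a_inv_def)
  qed
  with R show ?L
    by (auto simp: right_submodule_def right_submodule_axioms_def subgroup_def)
qed

lemma right_submodule_restrict_iff:
  assumes "right_module M" "right_submodule V M"
  shows "right_submodule W (restrict_to M V) \<longleftrightarrow> right_submodule W M \<and> W \<subseteq> V"
  using assms right_submodule_iff[OF right_module_restrict[OF assms]]
  by (auto simp: right_submodule_iff[OF assms(1)])

lemma right_submodule_carrier:
  "right_module M \<Longrightarrow> right_submodule (carrier M) M"
  by (simp add: right_submodule_iff right_module_def abelian_groupE(1,2) right_module.ract_closed)

lemma right_submodule_hull:
  assumes "right_module M" "A \<subseteq> carrier M"
  shows "right_submodule ((\<lambda>V. right_submodule V M) hull A) M"
proof -
  have "(\<lambda>V. right_submodule V M) hull A \<subseteq> carrier M"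
    by (rule hull_minimal) (simp_all add: assms right_submodule_carrier)
  then show ?thesis
    by (auto simp: right_submodule_iff[OF assms(1)] hull_def)
qed

text \<open>The submodules of the hull are the submodules of \<open>M\<close> contained in it, so
  the hull formed inside it is again all of it.\<close>

lemma generates_hull:
  assumes "right_module M" "A \<subseteq> carrier M"
  shows "generates (restrict_to M ((\<lambda>V. right_submodule V M) hull A)) A"
proof -
  let ?W = "(\<lambda>V. right_submodule V M) hull A"
  note W = right_submodule_hull[OF assms]
  have "(\<lambda>V. right_submodule V (restrict_to M ?W)) hull A = ?W"
  proof (rule hull_unique)
    fix V assume "A \<subseteq> V" "right_submodule V (restrict_to M ?W)"
    then show "?W \<subseteq> V"
      by (intro hull_minimal) (simp_all add: right_submodule_restrict_iff[OF assms(1) W])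
  qed (simp_all add: hull_subset right_submodule_restrict_iff[OF assms(1) W] W)
  then show ?thesis
    by (simp add: generates_def hull_subset)
qed

text \<open>What the two algebras have in common: \<open>p\<close> is r for the free monoid and 2r -
  1 for the free group, and \<open>q\<close> allows balls to exceed \<open>p ^ n\<close> by a
  bounded factor. The last assumption is B(m + n) = B(m) B(n).\<close>

locale exponential_growth =
  fixes type :: "'g::monoid_with_length itself" and p q :: nat
  assumes two_le: "2 \<le> p"
    and finite_word_ball: "finite (word_ball n :: 'g set)"
    and card_word_ball_ge: "p ^ n \<le> card (word_ball n :: 'g set)"
    and card_word_ball_le: "card (word_ball n :: 'g set) \<le> q * p ^ n"
    and word_ball_add: "word_ball (m + n) = {g + h | g h :: 'g. g \<in> word_ball m \<and> h \<in> word_ball n}"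
begin

text \<open>Turns a constant factor into a shift of the radius, which is the loss that
  \<open>growth_equiv\<close> permits: \<open>x * p ^ n \<le> p ^ (n + x)\<close>.\<close>

lemma le_power: "x \<le> p ^ x"
  by (rule order.trans[OF less_imp_le[OF less_exp] power_mono[OF two_le]]) simp

text \<open>The submodule generated by \<open>A\<close> is the witness. Its upper bound is
  automatic: \<open>A\<close> has at most \<open>card A * card (word_ball n)\<close> translates, and
  the factor \<open>card A * q\<close> becomes a shift.\<close>

lemma maximal_growthI:
  fixes M :: "('g \<Rightarrow>\<^sub>0 'k::field, 'm, 'z) rmodule_scheme"
  assumes M: "right_module M" and A: "finite A" "A \<subseteq> carrier M"
    and le: "\<And>n. card (word_ball n :: 'g set) \<le> growth M A (n + C)"
  shows "maximal_growth M"
proof -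
  let ?W = "(\<lambda>V. right_submodule V M) hull A"
  note W = right_submodule_hull[OF M A(2)]
  have "growth M A n \<le> card (word_ball (n + card A * q) :: 'g set)" for n
  proof -
    have "growth M A n \<le> card (translates M A (word_ball n))"
      using A translates_closed[OF M]
      by (simp add: growth_eq[OF M] linear_dim_span_le M finite_translates finite_word_ball)
    also have "\<dots> \<le> card A * card (word_ball n :: 'g set)"
      using A by (simp add: card_translates_le finite_word_ball)
    also have "\<dots> \<le> (card A * q) * p ^ n"
      using mult_left_mono[OF card_word_ball_le[of n], of "card A"] by (simp add: mult.assoc)
    also have "\<dots> \<le> p ^ (card A * q) * p ^ n"
      by (intro mult_right_mono le_power) simp
    also have "\<dots> = p ^ (n + card A * q)"
      by (simp add: power_add)
    also have "\<dots> \<le> card (word_ball (n + card A * q) :: 'g set)"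
      by (rule card_word_ball_ge)
    finally show ?thesis .
  qed
  then have "growth_equiv (growth M A) (growth (regular_module :: ('g \<Rightarrow>\<^sub>0 'k, _) rmodule) {1})"
    using le by (auto simp: growth_equiv_def growth_regular[OF finite_word_ball])
  moreover have "growth (restrict_to M ?W) A = growth M A"
    by (rule ext) (rule growth_restrict[OF M W hull_subset])
  ultimately have "fg_maximal_growth (restrict_to M ?W)"
    using A generates_hull[OF M A(2)] unfolding fg_maximal_growth_def by auto
  then show ?thesis
    using W by (auto simp: maximal_growth_def)
qed

text \<open>Converse of \<open>maximal_growthI\<close>: a generating set of a submodule has the same
  growth in \<open>M\<close>. Together they express maximal growth through finite subsets of
  \<open>M\<close> alone.\<close>

lemma maximal_growthE:
  fixes M :: "('g \<Rightarrow>\<^sub>0 'k::field, 'm, 'z) rmodule_scheme"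
  assumes M: "right_module M" and "maximal_growth M"
  obtains A C where "finite A" "A \<subseteq> carrier M"
    "\<And>n. card (word_ball n :: 'g set) \<le> growth M A (n + C)"
proof -
  obtain V A where V: "right_submodule V M" and A: "finite A" "generates (restrict_to M V) A"
    "growth_equiv (growth (restrict_to M V) A) (growth (regular_module :: ('g \<Rightarrow>\<^sub>0 'k, _) rmodule) {1})"
    using assms(2) by (auto simp: maximal_growth_def fg_maximal_growth_def)
  then have "A \<subseteq> V"
    by (simp add: generates_def)
  moreover have "V \<subseteq> carrier M"
    using V by (simp add: right_submodule_iff[OF M])
  ultimately show thesis
    using A that[of A] by (fastforce simp: growth_equiv_def growth_regular[OF finite_word_ball]
      growth_restrict[OF M V])
qed

text \<open>A finite set witnessing maximal growth inside \<open>V\<close> is also a witness in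
  \<open>M\<close>.\<close>

lemma maximal_growth_restrictD:
  fixes M :: "('g \<Rightarrow>\<^sub>0 'k::field, 'm, 'z) rmodule_scheme"
  assumes M: "right_module M" and V: "right_submodule V M" and "maximal_growth (restrict_to M V)"
  shows "maximal_growth M"
proof -
  obtain A C where A: "finite A" "A \<subseteq> carrier (restrict_to M V)"
    "\<And>n. card (word_ball n :: 'g set) \<le> growth (restrict_to M V) A (n + C)"
    using maximal_growthE[OF right_module_restrict[OF M V] assms(3)] by blast
  moreover have "V \<subseteq> carrier M"
    using V by (simp add: right_submodule_iff[OF M])
  ultimately show ?thesis
    by (intro maximal_growthI[OF M, of A C]) (auto simp: growth_restrict[OF M V])
qed

end

section \<open>Homomorphisms and quotients\<close>

text \<open>Stands for the quotient map. Linearity over the field is included, since scalars act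
  through the ring.\<close>

locale right_module_hom = M: right_module M + Q: right_module Q
  for M :: "('g::monoid_with_length \<Rightarrow>\<^sub>0 'k::field, 'm, 'z) rmodule_scheme"
    and Q :: "('g \<Rightarrow>\<^sub>0 'k, 'n, 'y) rmodule_scheme" +
  fixes f :: "'m \<Rightarrow> 'n"
  assumes closed: "x \<in> carrier M \<Longrightarrow> f x \<in> carrier Q"
    and add: "x \<in> carrier M \<Longrightarrow> y \<in> carrier M \<Longrightarrow> f (x \<oplus>\<^bsub>M\<^esub> y) = f x \<oplus>\<^bsub>Q\<^esub> f y"
    and ract: "x \<in> carrier M \<Longrightarrow> f (x \<triangleleft>\<^bsub>M\<^esub> r) = f x \<triangleleft>\<^bsub>Q\<^esub> r"
begin

lemma zero: "f \<zero>\<^bsub>M\<^esub> = \<zero>\<^bsub>Q\<^esub>"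
  using add[of "\<zero>\<^bsub>M\<^esub>" "\<zero>\<^bsub>M\<^esub>"] closed[of "\<zero>\<^bsub>M\<^esub>"] by (metis M.l_zero M.zero_closed Q.add.r_cancel_one')

lemma image_carrier: "S \<subseteq> carrier M \<Longrightarrow> f ` S \<subseteq> carrier Q"
  using closed by auto

lemma image_translates: "S \<subseteq> carrier M \<Longrightarrow> f ` translates M S G = translates Q (f ` S) G"
  by (force simp: translates_def ract image_iff)

text \<open>Preimages and images of subspaces are subspaces; each inclusion then follows from
  minimality of a span.\<close>

lemma image_linear_span:
  assumes S: "S \<subseteq> carrier M"
  shows "f ` linear_span M S = linear_span Q (f ` S)"
proof
  let ?T = "linear_span Q (f ` S)"
  have T: "linear_subspace Q ?T" "f ` S \<subseteq> ?T"
    using linear_subspace_span linear_span_superset Q.right_module_axioms image_carrier[OF S] by blast+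
  have "linear_subspace M {x \<in> carrier M. f x \<in> ?T}"
    using T by (auto simp: linear_subspace_def zero add ract)
  then have "linear_span M S \<subseteq> {x \<in> carrier M. f x \<in> ?T}"
    by (rule linear_span_minimal[OF M.right_module_axioms]) (use S T in auto)
  then show "f ` linear_span M S \<subseteq> ?T"
    by auto
next
  have U: "linear_subspace M (linear_span M S)" "S \<subseteq> linear_span M S"
    using linear_subspace_span linear_span_superset M.right_module_axioms S by blast+
  then have car: "linear_span M S \<subseteq> carrier M"
    by (simp add: linear_subspace_def)
  have "linear_subspace Q (f ` linear_span M S)"
    unfolding linear_subspace_def
  proof (intro conjI ballI allI)
    show "\<zero>\<^bsub>Q\<^esub> \<in> f ` linear_span M S"
      using U zero by (metis image_eqI linear_subspace_def)
  next
    fix x y assume "x \<in> f ` linear_span M S" "y \<in> f ` linear_span M S"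
    then show "x \<oplus>\<^bsub>Q\<^esub> y \<in> f ` linear_span M S"
      using U car by (force simp: linear_subspace_def add[symmetric] subset_iff)
  next
    fix x c assume "x \<in> f ` linear_span M S"
    then show "x \<triangleleft>\<^bsub>Q\<^esub> Poly_Mapping.single 0 c \<in> f ` linear_span M S"
      using U car by (force simp: linear_subspace_def ract[symmetric] subset_iff)
  qed (use car closed in auto)
  then show "linear_span Q (f ` S) \<subseteq> f ` linear_span M S"
    by (rule linear_span_minimal[OF Q.right_module_axioms]) (use U in auto)
qed

text \<open>\<open>T\<close> lifts a minimal spanning set of the span of the image. Each
  \<open>s\<close> in \<open>S\<close> agrees modulo the kernel with some \<open>t\<close> in the
  span of \<open>T\<close>, and \<open>D\<close> collects the differences.\<close>

lemma split_generators:
  assumes S: "finite S" "S \<subseteq> carrier M"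
  obtains D T where "finite D" "D \<subseteq> {x \<in> carrier M. f x = \<zero>\<^bsub>Q\<^esub>}" "finite T" "T \<subseteq> carrier M"
    "card T \<le> linear_dim Q (linear_span Q (f ` S))" "linear_span M (D \<union> T) = linear_span M S"
proof -
  note M = M.right_module_axioms and Q = Q.right_module_axioms
  let ?U = "linear_span M S"
  have U: "linear_subspace M ?U" "S \<subseteq> ?U"
    using linear_subspace_span[OF M S(2)] linear_span_superset[OF M S(2)] by auto
  then have UM: "?U \<subseteq> carrier M"
    by (simp add: linear_subspace_def)
  have "finite (f ` S)"
    using S by simp
  from linear_span_minimal_generators[OF Q this image_carrier[OF S(2)]]
  obtain T' where T': "finite T'" "T' \<subseteq> linear_span Q (f ` S)"
    "card T' = linear_dim Q (linear_span Q (f ` S))" "linear_span Q T' = linear_span Q (f ` S)"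
    by blast
  \<comment> \<open>One preimage per element of \<open>T'\<close>, chosen inside the span of
    \<open>S\<close>: thus \<open>T\<close> has the size of \<open>T'\<close> and does not enlarge
    the span.\<close>
  then obtain T where T: "T \<subseteq> ?U" "inj_on f T" "f ` T = T'"
    using subset_image_inj[of T' f ?U] image_linear_span[OF S(2)] by auto
  then have T_fin: "finite T" and T_card: "card T = linear_dim Q (linear_span Q (f ` S))"
    using T' by (auto simp: finite_image_iff card_image)
  have T_car: "T \<subseteq> carrier M"
    using T UM by auto
  have T_span: "linear_span M T \<subseteq> ?U"
    by (rule linear_span_minimal[OF M U(1) T(1)])
  have "\<exists>d. d \<in> ?U \<and> f d = \<zero>\<^bsub>Q\<^esub> \<and> (\<exists>t\<in>linear_span M T. s = d \<oplus>\<^bsub>M\<^esub> t)" if s: "s \<in> S" for s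
  proof -
    have "f s \<in> linear_span Q T'"
      using s T'(4) linear_span_superset[OF Q image_carrier[OF S(2)]] by auto
    then have "f s \<in> f ` linear_span M T"
      by (simp add: image_linear_span[OF T_car] T)
    then obtain t where t: "t \<in> linear_span M T" "f t = f s"
      by (metis imageE)
    have car: "s \<in> carrier M" "t \<in> carrier M"
      using s t S T_span UM by auto
    \<comment> \<open>This is s - t, with the negative written as a scalar multiple so that it lies
      in the subspace \<open>?U\<close>.\<close>
    let ?d = "s \<oplus>\<^bsub>M\<^esub> t \<triangleleft>\<^bsub>M\<^esub> Poly_Mapping.single 0 (- 1)"
    have "Poly_Mapping.single 0 (- 1) = (- 1 :: 'g \<Rightarrow>\<^sub>0 'k)"
      by (simp add: single_uminus)
    then have neg: "t \<triangleleft>\<^bsub>M\<^esub> Poly_Mapping.single 0 (- 1) \<oplus>\<^bsub>M\<^esub> t = \<zero>\<^bsub>M\<^esub>"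
      using M.ract_minus_one[OF car(2)] by simp
    have "s = ?d \<oplus>\<^bsub>M\<^esub> t"
      using neg car by (simp add: M.a_assoc)
    moreover have "s \<in> ?U" "t \<in> ?U"
      using U s t T_span by auto
    then have "?d \<in> ?U"
      using U(1) by (simp add: linear_subspace_def)
    moreover have "f ?d = \<zero>\<^bsub>Q\<^esub>"
    proof -
      have "f ?d = f t \<oplus>\<^bsub>Q\<^esub> f (t \<triangleleft>\<^bsub>M\<^esub> Poly_Mapping.single 0 (- 1))"
        using car t by (simp add: add)
      also have "\<dots> = f (t \<triangleleft>\<^bsub>M\<^esub> Poly_Mapping.single 0 (- 1) \<oplus>\<^bsub>M\<^esub> t)"
        using car by (simp add: add M.a_comm)
      finally show ?thesis
        using neg zero by simp
    qed
    ultimately show ?thesis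
      using t by blast
  qed
  then obtain d where d: "d s \<in> ?U" "f (d s) = \<zero>\<^bsub>Q\<^esub>" "\<exists>t\<in>linear_span M T. s = d s \<oplus>\<^bsub>M\<^esub> t"
    if "s \<in> S" for s
    by metis
  have DT: "d ` S \<union> T \<subseteq> ?U"
    using d(1) T(1) by blast
  let ?W = "linear_span M (d ` S \<union> T)"
  have WM: "d ` S \<union> T \<subseteq> carrier M"
    using DT UM by (rule subset_trans)
  note W = linear_subspace_span[OF M WM] linear_span_superset[OF M WM]
  have "linear_span M T \<subseteq> ?W"
    using linear_span_minimal[OF M W(1)] W(2) by blast
  have "S \<subseteq> ?W"
  proof
    fix s assume s: "s \<in> S"
    then obtain t where "t \<in> linear_span M T" "s = d s \<oplus>\<^bsub>M\<^esub> t"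
      using d(3) by blast
    moreover have "d s \<in> ?W"
      using s W(2) by blast
    ultimately show "s \<in> ?W"
      using W(1) \<open>linear_span M T \<subseteq> ?W\<close> unfolding linear_subspace_def by (metis subsetD)
  qed
  then have "?W = ?U"
    by (rule linear_span_eqI[OF M DT _ WM S(2)])
  moreover have "d ` S \<subseteq> {x \<in> carrier M. f x = \<zero>\<^bsub>Q\<^esub>}"
    using d(1,2) UM by blast
  ultimately show thesis
    using that[of "d ` S" T] S T_fin T_card T_car by simp
qed

end

text \<open>The translates of \<open>D \<union> T\<close> by B(j) span the same space as those of
  \<open>A\<close> by B(k + j). The part from \<open>T\<close> is merely counted, which gives the
  product term.\<close>

lemma (in exponential_growth) growth_add_le:
  assumes "right_module_hom (M :: ('g \<Rightarrow>\<^sub>0 'k::field, 'm, 'z) rmodule_scheme) Q f"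
    and A: "finite A" "A \<subseteq> carrier M"
  obtains D where "finite D" "D \<subseteq> {x \<in> carrier M. f x = \<zero>\<^bsub>Q\<^esub>}"
    "\<And>j. growth M A (k + j) \<le> growth M D j + growth Q (f ` A) k * card (word_ball j :: 'g set)"
proof -
  interpret right_module_hom M Q f by fact
  note M = M.right_module_axioms and Q = Q.right_module_axioms
  let ?S = "translates M A (word_ball k)"
  have S: "finite ?S" "?S \<subseteq> carrier M"
    using A by (simp_all add: finite_translates finite_word_ball translates_closed[OF M])
  obtain D T where D: "finite D" "D \<subseteq> {x \<in> carrier M. f x = \<zero>\<^bsub>Q\<^esub>}"
    and T: "finite T" "T \<subseteq> carrier M" "card T \<le> linear_dim Q (linear_span Q (f ` ?S))"
    and span: "linear_span M (D \<union> T) = linear_span M ?S"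
    using split_generators[OF S] .
  \<comment> \<open>\<open>f\<close> carries the translates of \<open>A\<close> by B(k) onto those
    of its image, so the bound on \<open>T\<close> is the growth of the image at
    \<open>k\<close>.\<close>
  have card_T: "card T \<le> growth Q (f ` A) k"
    using T A image_carrier growth_eq[OF Q, of "f ` A"] by (simp add: image_translates)
  have D_car: "D \<subseteq> carrier M"
    using D by auto
  then have DT: "D \<union> T \<subseteq> carrier M"
    using T by simp
  have "growth M A (k + j) \<le> growth M D j + growth Q (f ` A) k * card (word_ball j :: 'g set)" for j
  proof -
    let ?B = "word_ball j :: 'g set"
    have "translates M A (word_ball (k + j)) = translates M ?S ?B"
      by (simp add: translates_translates[OF M A(2)] word_ball_add)
    also have "linear_span M \<dots> = linear_span M (translates M (D \<union> T) ?B)"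
    proof (rule linear_span_eqI[OF M])
      show "translates M ?S ?B \<subseteq> linear_span M (translates M (D \<union> T) ?B)"
        using span linear_span_superset[OF M S(2)] by (intro translates_linear_span[OF M DT]) simp
      show "translates M (D \<union> T) ?B \<subseteq> linear_span M (translates M ?S ?B)"
        using span linear_span_superset[OF M DT] by (intro translates_linear_span[OF M S(2)]) simp
    qed (intro translates_closed[OF M] S(2) DT)+
    also have "translates M (D \<union> T) ?B = translates M D ?B \<union> translates M T ?B"
      by (auto simp: translates_def)
    finally have "growth M A (k + j) \<le> growth M D j + card (translates M T ?B)"
      using linear_dim_union_le[OF M, of "translates M D ?B" "translates M T ?B"] D T
      by (simp add: growth_eq[OF M] A D_car translates_closed[OF M] finite_translates finite_word_ball)
    also have "card (translates M T ?B) \<le> card T * card ?B"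
      using T by (simp add: card_translates_le finite_word_ball)
    also have "\<dots> \<le> growth Q (f ` A) k * card ?B"
      using card_T by (rule mult_right_mono) simp
    finally show ?thesis
      by simp
  qed
  with D show thesis
    using that by blast
qed

lemma right_module_hom_coset:
  fixes M :: "('g::monoid_with_length \<Rightarrow>\<^sub>0 'k::field, 'm, 'z) rmodule_scheme" (structure)
  assumes "right_module M" "right_submodule N M"
  shows "right_module_hom M (quotient_module M N) (\<lambda>m. N +> m)"
proof -
  interpret right_module M by fact
  interpret N: right_submodule N M by fact
  interpret ab: abelian_subgroup N M
    by (rule abelian_subgroupI3)
      (use N.subgroup_axioms abelian_group_axioms in \<open>auto intro: additive_subgroup.intro\<close>)
  \<comment> \<open>The action on a coset is defined as a union over its representatives; as
    \<open>N\<close> is stable under the action, they all yield the same coset.\<close>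
  have "(\<Union>m'\<in>N +> m. N +> (m' \<triangleleft> r)) = N +> (m \<triangleleft> r)" if m: "m \<in> carrier M" for m r
  proof -
    have "N +> (m' \<triangleleft> r) = N +> (m \<triangleleft> r)" if "m' \<in> N +> m" for m'
    proof -
      from that obtain h where h: "h \<in> N" "m' = h \<oplus> m"
        by (auto simp: a_r_coset_def r_coset_def)
      then have "m' \<triangleleft> r = h \<triangleleft> r \<oplus> m \<triangleleft> r"
        using m N.subset by (auto simp: ract_l_distr)
      then have "m' \<triangleleft> r \<in> N +> (m \<triangleleft> r)"
        using h N.ract_closed by (auto simp: a_r_coset_def r_coset_def)
      then show ?thesis
        using a_repr_independence[of "m' \<triangleleft> r" N "m \<triangleleft> r"] m N.subgroup_axioms by simp
    qed
    then show ?thesis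
      using ab.a_rcos_self[OF m] by blast
  qed
  moreover have "N +> m \<in> a_rcosets N" if "m \<in> carrier M" for m
    using that by (auto simp: A_RCOSETS_def RCOSETS_def a_r_coset_def)
  ultimately show ?thesis
    by (intro right_module_hom.intro right_module_hom_axioms.intro right_module_quotient assms)
      (simp_all add: quotient_module_def ab.a_rcos_sum)
qed

lemma coset_kernel:
  fixes M (structure)
  assumes "right_module M" "right_submodule N M"
  shows "{m \<in> carrier M. N +> m = \<zero>\<^bsub>quotient_module M N\<^esub>} \<subseteq> N"
proof -
  interpret right_module M by fact
  interpret N: right_submodule N M by fact
  interpret ab: abelian_subgroup N M
    by (rule abelian_subgroupI3)
      (use N.subgroup_axioms abelian_group_axioms in \<open>auto intro: additive_subgroup.intro\<close>)
  show ?thesis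
    using ab.a_rcos_self by (auto simp: quotient_module_def)
qed

section \<open>Extensions\<close>

context exponential_growth
begin

lemma maximal_growth_extension:
  fixes M :: "('g \<Rightarrow>\<^sub>0 'k::field, 'm, 'z) rmodule_scheme"
  assumes M: "right_module M" and N: "right_submodule N M" and "maximal_growth M"
  shows "maximal_growth (restrict_to M N) \<or> maximal_growth (quotient_module M N)"
proof (rule disjCI)
  let ?Q = "quotient_module M N"
  let ?f = "\<lambda>m. N +>\<^bsub>M\<^esub> m"
  let ?b = "\<lambda>n. card (word_ball n :: 'g set)"
  assume not_max: "\<not> maximal_growth ?Q"
  interpret right_module_hom M ?Q ?f
    by (rule right_module_hom_coset[OF M N])
  obtain A C where A: "finite A" "A \<subseteq> carrier M" and growth_A: "\<And>n. ?b n \<le> growth M A (n + C)"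
    using maximal_growthE[OF M assms(3)] by blast
  \<comment> \<open>In the estimate below, \<open>q * q\<close> comes from a product of two ball
    sizes and the other \<open>q\<close> from one more ball of radius \<open>j\<close>; the shift
    \<open>t\<close> absorbs both through \<open>t \<le> p ^ t\<close>.\<close>
  define t where "t = q * q + q"
  \<comment> \<open>If no such \<open>m\<close> existed, the image of \<open>A\<close> would give
    the quotient maximal growth with shift \<open>C + t\<close>. The splitting radius is k =
    \<open>m + (C + t)\<close>.\<close>
  obtain m where m: "growth ?Q (?f ` A) (m + (C + t)) < ?b m"
    using not_max maximal_growthI[OF Q.right_module_axioms, of "?f ` A" "C + t"] A image_carrier
    by (meson finite_imageI not_le_imp_less)
  obtain D where D: "finite D" "D \<subseteq> {x \<in> carrier M. ?f x = \<zero>\<^bsub>?Q\<^esub>}"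
    and growth_D: "\<And>j. growth M A (m + (C + t) + j) \<le>
      growth M D j + growth ?Q (?f ` A) (m + (C + t)) * ?b j"
    using growth_add_le[OF right_module_hom_axioms A, of "m + (C + t)"] by blast
  have DN: "D \<subseteq> N"
    using D coset_kernel[OF M N] by blast
  have "?b j \<le> growth M D j" for j
  proof -
    \<comment> \<open>Even with \<open>?b j\<close> added, the contribution of \<open>T\<close>
      stays below the growth of \<open>A\<close> at k + j; hence at least \<open>?b j\<close> is
      left for \<open>D\<close>.\<close>
    have "growth ?Q (?f ` A) (m + (C + t)) * ?b j \<le> (q * p ^ m) * (q * p ^ j)"
      using m card_word_ball_le[of m] card_word_ball_le[of j] by (intro mult_mono) auto
    then have "growth ?Q (?f ` A) (m + (C + t)) * ?b j + ?b j \<le> q * q * p ^ (m + j) + q * p ^ j"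
      using card_word_ball_le[of j] by (simp add: power_add algebra_simps)
    also have "\<dots> \<le> q * q * p ^ (m + j) + q * p ^ (m + j)"
      using two_le by (intro add_left_mono mult_left_mono power_increasing) auto
    also have "\<dots> = t * p ^ (m + j)"
      by (simp add: t_def algebra_simps)
    also have "\<dots> \<le> p ^ t * p ^ (m + j)"
      by (intro mult_right_mono le_power) simp
    also have "\<dots> = p ^ (m + t + j)"
      by (simp add: power_add)
    also have "\<dots> \<le> growth M A (m + t + j + C)"
      using card_word_ball_ge[of "m + t + j"] growth_A[of "m + t + j"] by simp
    also have "\<dots> = growth M A (m + (C + t) + j)"
      by (simp add: ac_simps)
    finally show ?thesis
      using growth_D[of j] by simp
  qed
  then show "maximal_growth (restrict_to M N)"
    using D(1) DN by (intro maximal_growthI[OF right_module_restrict[OF M N], of D 0])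
      (simp_all add: growth_restrict[OF M N])
qed

text \<open>Contrapositively, maximal growth of a submodule passes to \<open>M\<close> and from
  there to \<open>N\<close> or the quotient, each of which is a submodule of itself.\<close>

lemma no_maximal_growth_extension:
  fixes M :: "('g \<Rightarrow>\<^sub>0 'k::field, 'm, 'z) rmodule_scheme"
  assumes M: "right_module M" and N: "right_submodule N M"
    and "no_maximal_growth (restrict_to M N)" "no_maximal_growth (quotient_module M N)"
  shows "no_maximal_growth M"
proof -
  have "\<not> maximal_growth (restrict_to M N)"
    using assms(3) right_submodule_carrier[OF right_module_restrict[OF M N]]
    by (auto simp: no_maximal_growth_def)
  \<comment> \<open>Restricting to the full carrier gives back the same record, so the hypothesis on
    submodules speaks of the quotient itself.\<close>
  moreover have "restrict_to (quotient_module M N) (carrier (quotient_module M N)) = quotient_module M N"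
    by (simp add: quotient_module_def)
  then have "\<not> maximal_growth (quotient_module M N)"
    using assms(4) right_submodule_carrier[OF right_module_quotient[OF M N]]
    by (metis no_maximal_growth_def)
  ultimately show ?thesis
    using maximal_growth_extension[OF M N] maximal_growth_restrictD[OF M] M
    by (auto simp: no_maximal_growth_def)
qed

end

section \<open>Balls in free monoids and free groups\<close>

text \<open>Passes from spheres to balls: as the ratio is at least 2, a geometric sum is at most
  twice its last term.\<close>

lemma geometric_bounds:
  fixes s :: "nat \<Rightarrow> nat"
  assumes "2 \<le> p" "\<And>n. p ^ n \<le> s n" "\<And>n. s n \<le> c * p ^ n"
  shows "p ^ n \<le> (\<Sum>i\<le>n. s i)" "(\<Sum>i\<le>n. s i) \<le> 2 * c * p ^ n"
proof -
  show "p ^ n \<le> (\<Sum>i\<le>n. s i)"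
    using assms(2)[of n] member_le_sum[of n "{..n}" s] by simp
  have "(\<Sum>i\<le>n. p ^ i) \<le> 2 * p ^ n"
  proof (induction n)
    case (Suc n)
    have "2 * p ^ n \<le> p * p ^ n"
      using assms(1) by (rule mult_right_mono) simp
    with Suc show ?case
      unfolding sum.atMost_Suc power_Suc by linarith
  qed simp
  then have "c * (\<Sum>i\<le>n. p ^ i) \<le> c * (2 * p ^ n)"
    by (rule mult_left_mono) simp
  then show "(\<Sum>i\<le>n. s i) \<le> 2 * c * p ^ n"
    using sum_mono[of "{..n}" s "\<lambda>i. c * p ^ i"] assms(3)
    by (simp add: sum_distrib_left algebra_simps)
qed

lemma card_word_ball:
  assumes "\<And>i. finite {g :: 'g::monoid_with_length. wlen g = i}"
  shows "finite (word_ball n :: 'g set)"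
    "card (word_ball n :: 'g set) = (\<Sum>i\<le>n. card {g :: 'g. wlen g = i})"
proof -
  have eq: "(word_ball n :: 'g set) = (\<Union>i\<in>{..n}. {g. wlen g = i})"
    by (auto simp: word_ball_def)
  show "finite (word_ball n :: 'g set)"
    unfolding eq using assms by blast
  show "card (word_ball n :: 'g set) = (\<Sum>i\<le>n. card {g :: 'g. wlen g = i})"
    unfolding eq using assms by (intro card_UN_disjoint) auto
qed

text \<open>Spheres are easier to count than balls; the factor 2 is that of the geometric sum. The
  last two assumptions give the two inclusions of \<open>word_ball_add\<close>.\<close>

lemma exponential_growthI:
  assumes "2 \<le> p" "\<And>n. finite {g :: 'g::monoid_with_length. wlen g = n}"
    and "\<And>n. p ^ n \<le> card {g :: 'g. wlen g = n}" "\<And>n. card {g :: 'g. wlen g = n} \<le> c * p ^ n"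
    and le: "\<And>g h :: 'g. wlen (g + h) \<le> wlen g + wlen h"
    and split: "\<And>(g :: 'g) m n. wlen g \<le> m + n \<Longrightarrow> \<exists>u v. g = u + v \<and> wlen u \<le> m \<and> wlen v \<le> n"
  shows "exponential_growth TYPE('g) p (2 * c)"
proof
  fix m n
  show "word_ball (m + n) = {g + h | g h :: 'g. g \<in> word_ball m \<and> h \<in> word_ball n}"
    unfolding word_ball_def using split le by (fastforce intro: order_trans add_mono)
qed (simp_all add: card_word_ball assms geometric_bounds[where p = p and c = c])

lemma card_free_monoid_sphere:
  "finite {g :: 'x::finite free_monoid. wlen g = n}"
  "card {g :: 'x::finite free_monoid. wlen g = n} = CARD('x) ^ n"
proof -
  have eq: "{g :: 'x free_monoid. wlen g = n} = Word ` {w. set w \<subseteq> UNIV \<and> length w = n}"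
    by (auto simp: wlen_free_monoid_def image_iff) (metis free_monoid.collapse)
  show "finite {g :: 'x::finite free_monoid. wlen g = n}"
    unfolding eq by (intro finite_imageI finite_lists_length_eq) simp
  show "card {g :: 'x::finite free_monoid. wlen g = n} = CARD('x) ^ n"
    unfolding eq using card_lists_length_eq[of "UNIV :: 'x set" n] by (simp add: card_image inj_on_def)
qed

lemma exponential_growth_free_monoid:
  assumes "CARD('x::finite) > 1"
  shows "exponential_growth TYPE('x free_monoid) (CARD('x)) 2"
proof -
  \<comment> \<open>Spheres have exactly \<open>CARD('x) ^ n\<close> elements, hence c = 1.\<close>
  have "exponential_growth TYPE('x free_monoid) (CARD('x)) (2 * 1)"
  proof (rule exponential_growthI)
    fix g :: "'x free_monoid" and m n assume "wlen g \<le> m + n"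
    then show "\<exists>u v. g = u + v \<and> wlen u \<le> m \<and> wlen v \<le> n"
      by (intro exI[of _ "Word (take m (letters g))"] exI[of _ "Word (drop m (letters g))"])
        (auto simp: plus_free_monoid_def wlen_free_monoid_def)
  next
    fix g h :: "'x free_monoid"
    show "wlen (g + h) \<le> wlen g + wlen h"
      by (simp add: plus_free_monoid_def wlen_free_monoid_def)
  qed (use assms in \<open>simp_all add: card_free_monoid_sphere\<close>)
  then show ?thesis
    by simp
qed

section \<open>Reduced words and balls in the free group\<close>

lemma reduced_Cons: "reduced (a # w) \<longleftrightarrow> reduced w \<and> (w = [] \<or> hd w \<noteq> inv_letter a)"
  by (cases w) (auto simp: reduced_def)

lemma reduced_appendD: "reduced (u @ v) \<Longrightarrow> reduced u \<and> reduced v"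
  by (simp add: reduced_def successively_append_iff)

text \<open>In a reduced concatenation nothing cancels; hence a reduced word can be factored at any
  position.\<close>

lemma foldr_lmult_append: "reduced (u @ v) \<Longrightarrow> foldr lmult u v = u @ v"
  using foldr_lmult_Nil[of "u @ v"] foldr_lmult_Nil[of v] reduced_appendD[of u v] by simp

lemma length_foldr_lmult_le: "length (foldr lmult u v) \<le> length u + length v"
proof (induction u)
  case (Cons a u)
  moreover have "length (lmult a w) \<le> Suc (length w)" for w
    by (auto simp: lmult_def split: list.split)
  ultimately show ?case
    by (auto intro: order_trans)
qed simp

definition reduced_words :: "nat \<Rightarrow> ('x \<times> bool) list set"
  where "reduced_words n = {w. reduced w \<and> length w = n}"

lemma finite_reduced_words: "finite (reduced_words n :: ('x::finite \<times> bool) list set)"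
  by (rule finite_subset[OF _ finite_lists_length_eq[of UNIV n]]) (auto simp: reduced_words_def)

text \<open>A nonempty reduced word extends on the left by every letter but the inverse of its head.
  The word comes first in the \<open>SIGMA\<close> because it restricts the letter, and length at
  least 1 makes \<open>hd\<close> meaningful.\<close>

lemma card_reduced_words_Suc_Suc:
  "card (reduced_words (Suc (Suc n)) :: ('x::finite \<times> bool) list set) =
    (2 * CARD('x) - 1) * card (reduced_words (Suc n) :: ('x \<times> bool) list set)"
proof -
  let ?S = "SIGMA w:reduced_words (Suc n) :: ('x \<times> bool) list set. {a. hd w \<noteq> inv_letter a}"
  have "reduced_words (Suc (Suc n)) = (\<lambda>(w, a). a # w) ` ?S"
  proof (intro equalityI subsetI)
    fix w :: "('x \<times> bool) list" assume w: "w \<in> reduced_words (Suc (Suc n))"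
    then obtain a u where "w = a # u" "length u = Suc n"
      by (auto simp: reduced_words_def length_Suc_conv)
    with w show "w \<in> (\<lambda>(w, a). a # w) ` ?S"
      by (auto simp: reduced_words_def reduced_Cons image_iff)
  qed (auto simp: reduced_words_def reduced_Cons)
  moreover have "inj_on (\<lambda>(w, a). a # w) ?S"
    by (auto simp: inj_on_def)
  moreover have "card {a :: 'x \<times> bool. hd w \<noteq> inv_letter a} = 2 * CARD('x) - 1" for w
  proof -
    have "{a. hd w \<noteq> inv_letter a} = UNIV - {inv_letter (hd w)}"
      by auto
    then show ?thesis
      by (simp add: card_Diff_singleton card_prod mult.commute)
  qed
  ultimately show ?thesis
    by (simp add: card_image card_SigmaI finite_reduced_words)
qed

text \<open>The induction starts at length 1, where the only letter is unrestricted; this accounts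
  for the single factor 2r among factors 2r - 1.\<close>

lemma card_reduced_words_Suc:
  "card (reduced_words (Suc n) :: ('x::finite \<times> bool) list set) =
    2 * CARD('x) * (2 * CARD('x) - 1) ^ n"
proof (induction n)
  case 0
  have "reduced_words (Suc 0) = (\<lambda>a :: 'x \<times> bool. [a]) ` UNIV"
    by (auto simp: reduced_words_def length_Suc_conv reduced_def)
  then show ?case
    by (simp add: card_image inj_on_def card_prod mult.commute)
qed (simp add: card_reduced_words_Suc_Suc)

lemma card_reduced_words_bounds:
  fixes n
  assumes "CARD('x::finite) > 1"
  defines "p \<equiv> 2 * CARD('x) - 1"
  shows "p ^ n \<le> card (reduced_words n :: ('x \<times> bool) list set)"
    "card (reduced_words n :: ('x \<times> bool) list set) \<le> 2 * p ^ n"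
proof -
  \<comment> \<open>As 2r = p + 1, the count \<open>2 * CARD('x) * p ^ (n - 1)\<close> for n > 0
    lies between \<open>p ^ n\<close> and \<open>2 * p ^ n\<close>; the empty word is the case n =
    0.\<close>
  have p: "p \<le> 2 * CARD('x)" "2 * CARD('x) \<le> 2 * p"
    using assms by auto
  have 0: "reduced_words 0 = {[] :: ('x \<times> bool) list}"
    by (auto simp: reduced_words_def)
  show "p ^ n \<le> card (reduced_words n :: ('x \<times> bool) list set)"
    using mult_right_mono[OF p(1)] by (cases n) (simp_all add: 0 card_reduced_words_Suc p_def)
  show "card (reduced_words n :: ('x \<times> bool) list set) \<le> 2 * p ^ n"
    using mult_right_mono[OF p(2), of "p ^ (n - 1)"]
    by (cases n) (simp_all add: 0 card_reduced_words_Suc p_def)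
qed

lemma free_group_sphere:
  "{g :: 'x free_group. wlen g = n} = Abs_free_group ` reduced_words n"
proof (intro equalityI subsetI)
  fix g :: "'x free_group" assume "g \<in> {g. wlen g = n}"
  then show "g \<in> Abs_free_group ` reduced_words n"
    using reduced_word[of g] reduced_word_inverse[of g]
    by (auto simp: reduced_words_def wlen_free_group.rep_eq intro!: image_eqI[of _ _ "reduced_word g"])
qed (auto simp: reduced_words_def wlen_free_group.rep_eq Abs_free_group_inverse)

lemma card_free_group_sphere:
  "finite {g :: 'x::finite free_group. wlen g = n}"
  "card {g :: 'x::finite free_group. wlen g = n} = card (reduced_words n :: ('x \<times> bool) list set)"
proof -
  have "inj_on Abs_free_group (reduced_words n :: ('x \<times> bool) list set)"
    by (auto simp: inj_on_def reduced_words_def Abs_free_group_inject)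
  then show "finite {g :: 'x free_group. wlen g = n}"
    "card {g :: 'x free_group. wlen g = n} = card (reduced_words n :: ('x \<times> bool) list set)"
    by (simp_all add: free_group_sphere card_image finite_reduced_words)
qed

lemma exponential_growth_free_group:
  assumes "CARD('x::finite) > 1"
  shows "exponential_growth TYPE('x free_group) (2 * CARD('x) - 1) 4"
proof -
  \<comment> \<open>Spheres satisfy the bound with c = 2, which is doubled for balls.\<close>
  have "exponential_growth TYPE('x free_group) (2 * CARD('x) - 1) (2 * 2)"
  proof (rule exponential_growthI)
    fix g h :: "'x free_group"
    show "wlen (g + h) \<le> wlen g + wlen h"
      by transfer (rule length_foldr_lmult_le)
  next
    fix g :: "'x free_group" and m n assume "wlen g \<le> m + n"
    then show "\<exists>u v. g = u + v \<and> wlen u \<le> m \<and> wlen v \<le> n"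
    proof transfer
      fix w :: "('x \<times> bool) list" and m n assume w: "reduced w" "length w \<le> m + n"
      \<comment> \<open>Both pieces of a reduced word are reduced, so they are elements of the group
        whose product is \<open>w\<close> without cancellation.\<close>
      have "reduced (take m w)" "reduced (drop m w)"
        using reduced_appendD[of "take m w" "drop m w"] w by simp_all
      then show "\<exists>u\<in>Collect reduced. \<exists>v\<in>Collect reduced.
          w = foldr lmult u v \<and> length u \<le> m \<and> length v \<le> n"
        using w foldr_lmult_append[of "take m w" "drop m w"]
        by (intro bexI[of _ "take m w"] bexI[of _ "drop m w"]) auto
    qed
  qed (use assms card_reduced_words_bounds[OF assms] in \<open>auto simp: card_free_group_sphere\<close>)
  then show ?thesis
    by simp
qed

theorem theorem2:
  assumes "CARD('x::finite) > 1"
  shows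
    "(\<forall>(M :: (('x, 'k::field) free_algebra, 'm) rmodule) N.
        right_module M \<and> right_submodule N M \<and> maximal_growth M \<longrightarrow>
        maximal_growth (restrict_to M N) \<or> maximal_growth (quotient_module M N)) \<and>
     (\<forall>(M :: (('x, 'k) free_algebra, 'm) rmodule) N.
        right_module M \<and> right_submodule N M \<and>
        no_maximal_growth (restrict_to M N) \<and> no_maximal_growth (quotient_module M N) \<longrightarrow>
        no_maximal_growth M) \<and>
     (\<forall>(M :: (('x, 'k) free_group_algebra, 'm) rmodule) N.
        right_module M \<and> right_submodule N M \<and> maximal_growth M \<longrightarrow>
        maximal_growth (restrict_to M N) \<or> maximal_growth (quotient_module M N)) \<and>
     (\<forall>(M :: (('x, 'k) free_group_algebra, 'm) rmodule) N.
        right_module M \<and> right_submodule N M \<and>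
        no_maximal_growth (restrict_to M N) \<and> no_maximal_growth (quotient_module M N) \<longrightarrow>
        no_maximal_growth M)"
proof -
  interpret A: exponential_growth "TYPE('x free_monoid)" "CARD('x)" 2
    by (rule exponential_growth_free_monoid[OF assms])
  interpret F: exponential_growth "TYPE('x free_group)" "2 * CARD('x) - 1" 4
    by (rule exponential_growth_free_group[OF assms])
  show ?thesis
    by (intro conjI allI impI; elim conjE; rule A.maximal_growth_extension A.no_maximal_growth_extension
        F.maximal_growth_extension F.no_maximal_growth_extension)
qed

end
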